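(* Let $\delta,\lambda>0$ be constants, $h\equiv 0$, and let $g(x)=\lambda-\lambda x^2$ for $|x|\le 1$ and $g(x)=0$ for $|x|>1$. Consider $$\alpha=\sqrt{1-\frac{1}{\lambda\sqrt{2\delta}}},\qquad A=\lambda(1-\alpha^2)e^{\sqrt{2\delta}\,\alpha}.$$ Then $\alpha$ is a well-defined real number strictly greater than $\frac{1}{2\lambda}$ and there exists $\beta\in[0,\alpha)$ satisfying $$\lambda\beta^2-\beta=\lambda\alpha^2-\alpha$$ if and only if $$\frac12\left(-\frac{1}{\sqrt{2\delta}}+\sqrt{\frac{1}{2\delta}+1}\right)^{-1}<\lambda\le\left(-\frac{1}{2\sqrt{2\delta}}+\sqrt{\frac{1}{8\delta}+1}\right)^{-1},$$ in which case $\beta<\frac{1}{2\lambda}$. If the problem data satisfy these inequalities, then $A>0$, $\alpha\in(0,1)$, and the function $$u(x)=\begin{cases}-\lambda x^2+\lambda,&|x|\le\beta,\\ -|x|-\lambda\alpha^2+\alpha+\lambda,&\beta<|x|\le\alpha,\\ Ae^{-\sqrt{2\delta}\,|x|},&|x|>\alpha,\end{cases}$$ is a candidate for the value function (as defined in the context).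
   Context: Candidate for the value function (for the data $b\equiv0$, $\sigma\equiv1$, constant discount rate $\delta$, running payoff $h\equiv0$, terminal payoff $g$ as in the statement). Let $\mathcal{L}u(x)=\frac12u''(x)-\delta u(x)$. A candidate is a continuous $u:\mathbb{R}\to\mathbb{R}_+$ that is $C^1$ with absolutely continuous first derivative inside $\mathbb{R}\setminus\mathcal{B}$, where $\mathcal{B}$ is a finite set, that satisfies $|u'(x)|\le 1$ for all $x\in\mathbb{R}\setminus\mathcal{B}$, and that has properties (i)–(iii) below, where $\mathcal{C}=\mathrm{cl}\big[\mathrm{int}\{x\in\mathbb{R}\setminus\mathcal{B}: |u'(x)|=1\}\big]$, $\mathcal{S}_{\mathcal W}=\{x: u(x)=g(x)\}$, $\mathcal{S}_{\mathcal C}=\mathrm{cl}\{x: u(x)<g(x)\}$, $\mathcal{S}=\mathcal{S}_{\mathcal W}\cup\mathcal{S}_{\mathcal C}$, $\mathcal{W}=\mathbb{R}\setminus(\mathcal{C}\cup\mathcal{S})$: (i) each of $\mathcal{C},\mathcal{S}_{\mathcal W},\mathcal{S}_{\mathcal C}$ is a finite union of intervals (single points allowed), and $\mathcal{B}\subseteq\mathcal{S}_{\mathcal C}\subseteq\mathcal{C}$; (ii) $\mathcal{L}u+h=0$ Lebesgue-a.e. in $\mathcal{W}$; $\mathcal{L}u+h\ge0$ a.e. in $\mathrm{int}(\mathcal{C}\setminus\mathcal{S})$; $\mathcal{L}u+h=\mathcal{L}g+h\le0$ a.e. in $\mathrm{int}\,\mathcal{S}_{\mathcal W}$ (no sign condition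 in $\mathrm{int}\,\mathcal{S}_{\mathcal C}\setminus\mathcal{B}$); (iii) for every $c\in\mathcal{B}$, with $u'_\mp(c)$ the left/right derivatives, either $u'_-(c)=1$ and $u'_+(c)<1$, or $u'_-(c)>-1$ and $u'_+(c)=-1$. The number $\alpha$ is a well-defined real number exactly when $\lambda\sqrt{2\delta}\ge1$. *)

theory Defs
  imports "HOL-Analysis.Analysis"
begin

text \<open>The library has absolute continuity of measures only; this is the usual notion for
  functions on a compact interval, with a finite family of non-overlapping subintervals
  given by the set of pairs of their end points.\<close>

definition abs_cont_on_interval :: "real \<Rightarrow> real \<Rightarrow> (real \<Rightarrow> real) \<Rightarrow> bool" where
  "abs_cont_on_interval a b f \<longleftrightarrow>
     (\<forall>\<epsilon>>0. \<exists>\<eta>>0. \<forall>I :: (real \<times> real) set.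
        finite I \<and> (\<forall>(s, t)\<in>I. a \<le> s \<and> s < t \<and> t \<le> b) \<and>
        pairwise (\<lambda>(s, t) (s', t'). disjnt {s<..<t} {s'<..<t'}) I \<and>
        (\<Sum>(s, t)\<in>I. t - s) < \<eta>
        \<longrightarrow> (\<Sum>(s, t)\<in>I. \<bar>f t - f s\<bar>) < \<epsilon>)"

text \<open>On a general (here: open) set, absolute continuity is understood locally, i.e. on
  every compact interval contained in the set.\<close>

definition abs_cont_inside :: "real set \<Rightarrow> (real \<Rightarrow> real) \<Rightarrow> bool" where
  "abs_cont_inside X f \<longleftrightarrow>
     (\<forall>a b. a \<le> b \<and> {a..b} \<subseteq> X \<longrightarrow> abs_cont_on_interval a b f)"

definition finite_union_of_intervals :: "real set \<Rightarrow> bool" where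
  "finite_union_of_intervals X \<longleftrightarrow>
     (\<exists>F. finite F \<and> (\<forall>I\<in>F. is_interval I) \<and> X = \<Union>F)"

text \<open>The generator for zero drift, unit volatility and constant discount rate. It is only
  applied under an almost-everywhere quantifier to functions whose first derivative exists and
  is locally absolutely continuous near the points considered, so that the second derivative
  exists almost everywhere there.\<close>

definition gen_L :: "real \<Rightarrow> (real \<Rightarrow> real) \<Rightarrow> real \<Rightarrow> real" where
  "gen_L \<delta> u x = 1/2 * deriv (deriv u) x - \<delta> * u x"

definition control_region :: "real set \<Rightarrow> (real \<Rightarrow> real) \<Rightarrow> real set" where
  "control_region B u = closure (interior {x. x \<notin> B \<and> \<bar>deriv u x\<bar> = 1})"

definition stop_region_W :: "(real \<Rightarrow> real) \<Rightarrow> (real \<Rightarrow> real) \<Rightarrow> real set" where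
  "stop_region_W g u = {x. u x = g x}"

definition stop_region_C :: "(real \<Rightarrow> real) \<Rightarrow> (real \<Rightarrow> real) \<Rightarrow> real set" where
  "stop_region_C g u = closure {x. u x < g x}"

definition stop_region :: "(real \<Rightarrow> real) \<Rightarrow> (real \<Rightarrow> real) \<Rightarrow> real set" where
  "stop_region g u = stop_region_W g u \<union> stop_region_C g u"

definition wait_region :: "real set \<Rightarrow> (real \<Rightarrow> real) \<Rightarrow> (real \<Rightarrow> real) \<Rightarrow> real set" where
  "wait_region B g u = - (control_region B u \<union> stop_region g u)"

definition candidate_wrt ::
  "real \<Rightarrow> (real \<Rightarrow> real) \<Rightarrow> (real \<Rightarrow> real) \<Rightarrow> real set \<Rightarrow> (real \<Rightarrow> real) \<Rightarrow> bool" where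
  "candidate_wrt \<delta> h g B u \<longleftrightarrow>
     finite B \<and>
     (\<forall>x. 0 \<le> u x) \<and> continuous_on UNIV u \<and>
     (\<forall>x. x \<notin> B \<longrightarrow> u differentiable (at x)) \<and>
     continuous_on (- B) (deriv u) \<and> abs_cont_inside (- B) (deriv u) \<and>
     (\<forall>x. x \<notin> B \<longrightarrow> \<bar>deriv u x\<bar> \<le> 1) \<and>
     finite_union_of_intervals (control_region B u) \<and>
     finite_union_of_intervals (stop_region_W g u) \<and>
     finite_union_of_intervals (stop_region_C g u) \<and>
     B \<subseteq> stop_region_C g u \<and> stop_region_C g u \<subseteq> control_region B u \<and>
     (AE x in lebesgue. x \<in> wait_region B g u \<longrightarrow> gen_L \<delta> u x + h x = 0) \<and>
     (AE x in lebesgue. x \<in> interior (control_region B u - stop_region g u) \<longrightarrow>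
        gen_L \<delta> u x + h x \<ge> 0) \<and>
     (AE x in lebesgue. x \<in> interior (stop_region_W g u) \<longrightarrow>
        gen_L \<delta> u x + h x = gen_L \<delta> g x + h x \<and> gen_L \<delta> g x + h x \<le> 0) \<and>
     (\<forall>c\<in>B. \<exists>l r. (u has_real_derivative l) (at_left c) \<and>
        (u has_real_derivative r) (at_right c) \<and>
        (l = 1 \<and> r < 1 \<or> l > -1 \<and> r = -1))"

definition candidate ::
  "real \<Rightarrow> (real \<Rightarrow> real) \<Rightarrow> (real \<Rightarrow> real) \<Rightarrow> (real \<Rightarrow> real) \<Rightarrow> bool" where
  "candidate \<delta> h g u \<longleftrightarrow> (\<exists>B. candidate_wrt \<delta> h g B u)"

definition payoff_g :: "real \<Rightarrow> real \<Rightarrow> real" where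
  "payoff_g lam x = (if \<bar>x\<bar> \<le> 1 then lam - lam * x\<^sup>2 else 0)"

text \<open>Since \<^const>\<open>sqrt\<close> is total (odd on the negative half line), well-definedness of
  \<open>\<alpha>\<close> is a separate condition.\<close>

definition alpha_well_defined :: "real \<Rightarrow> real \<Rightarrow> bool" where
  "alpha_well_defined \<delta> lam \<longleftrightarrow> 0 \<le> 1 - 1 / (lam * sqrt (2 * \<delta>))"

definition alpha :: "real \<Rightarrow> real \<Rightarrow> real" where
  "alpha \<delta> lam = sqrt (1 - 1 / (lam * sqrt (2 * \<delta>)))"

definition coeff_A :: "real \<Rightarrow> real \<Rightarrow> real" where
  "coeff_A \<delta> lam = lam * (1 - (alpha \<delta> lam)\<^sup>2) * exp (sqrt (2 * \<delta>) * alpha \<delta> lam)"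

definition is_beta :: "real \<Rightarrow> real \<Rightarrow> real \<Rightarrow> bool" where
  "is_beta \<delta> lam \<beta> \<longleftrightarrow>
     0 \<le> \<beta> \<and> \<beta> < alpha \<delta> lam \<and>
     lam * \<beta>\<^sup>2 - \<beta> = lam * (alpha \<delta> lam)\<^sup>2 - alpha \<delta> lam"

definition cand_u :: "real \<Rightarrow> real \<Rightarrow> real \<Rightarrow> real \<Rightarrow> real" where
  "cand_u \<delta> lam \<beta> x =
     (if \<bar>x\<bar> \<le> \<beta> then - lam * x\<^sup>2 + lam
      else if \<bar>x\<bar> \<le> alpha \<delta> lam
      then - \<bar>x\<bar> - lam * (alpha \<delta> lam)\<^sup>2 + alpha \<delta> lam + lam
      else coeff_A \<delta> lam * exp (- sqrt (2 * \<delta>) * \<bar>x\<bar>))"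

definition data_ineqs :: "real \<Rightarrow> real \<Rightarrow> bool" where
  "data_ineqs \<delta> lam \<longleftrightarrow>
     1/2 * inverse (- (1 / sqrt (2 * \<delta>)) + sqrt (1 / (2 * \<delta>) + 1)) < lam \<and>
     lam \<le> inverse (- (1 / (2 * sqrt (2 * \<delta>))) + sqrt (1 / (8 * \<delta>) + 1))"

end

theory Submission
  imports Defs
begin

text \<open>
  Write \<open>s = sqrt (2 * \<delta>)\<close>. The equation for \<open>\<beta>\<close> factors as
  \<open>(\<beta> - \<alpha>) * (lam * (\<beta> + \<alpha>) - 1) = 0\<close>, so a root below \<open>\<alpha>\<close> can only be
  \<open>\<beta> = 1 / lam - \<alpha>\<close>; it is below \<open>\<alpha>\<close> exactly when \<open>\<alpha> > 1 / (2 * lam)\<close> and nonnegative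
  exactly when \<open>\<alpha> \<le> 1 / lam\<close> (\<open>is_beta_iff\<close>). After squaring, both comparisons are quadratic
  inequalities in \<open>lam\<close> with one positive root, and these roots are the two bounds on the data
  (\<open>inverse_threshold_iff\<close>).

  The choice of \<open>\<alpha>\<close> amounts to \<open>s * lam * (1 - \<alpha>\<^sup>2) = 1\<close>. Hence the exponential, which by the
  choice of \<open>A\<close> meets \<open>g\<close> at \<open>\<alpha>\<close>, leaves that point with slope \<open>- 1\<close> and continues the line of
  slope \<open>- 1\<close> smoothly, while \<open>lam * (\<alpha> + \<beta>) = 1\<close> says that this line is the chord of the
  parabola \<open>g\<close> over \<open>[\<beta>, \<alpha>]\<close>. So the only kinks of \<open>u\<close> are at \<open>\<beta>\<close> and \<open>- \<beta>\<close>, and everything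
  else is read off from the picture. A chord of a strictly concave function lies below it, so
  \<open>u < g\<close> between \<open>\<beta>\<close> and \<open>\<alpha>\<close> (\<open>u_less_g\<close>). Beyond \<open>\<alpha>\<close> the convex exponential lies above its
  tangent, which descends more slowly than \<open>g\<close>, so \<open>u > g\<close> there (\<open>u_greater_g\<close>). The slope
  has modulus \<open>1\<close> exactly on \<open>\<beta> < \<bar>x\<bar> \<le> \<alpha>\<close>. Therefore the control region and the second stopping
  region are the same set \<open>\<beta> \<le> \<bar>x\<bar> \<le> \<alpha>\<close>, the stopping region where \<open>u = g\<close> is
  \<open>\<bar>x\<bar> \<le> \<beta>\<close> together with the two points \<open>\<bar>x\<bar> = \<alpha>\<close>, and waiting takes place on
  \<open>\<bar>x\<bar> > \<alpha>\<close>, where \<open>u\<close> solves \<open>u'' = 2 * \<delta> * u\<close>. All the arguments include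
  \<open>\<beta> = 0\<close>, where the two kinks merge into one with slopes \<open>1\<close> and \<open>- 1\<close>.
\<close>

section \<open>Calculus and topology on the real line\<close>

text \<open>The quadratic has the roots \<open>p \<plusminus> sqrt (p\<^sup>2 + 1)\<close>, whose product is \<open>- 1\<close>; thus the inverse
  below is its positive root. With \<open>p = 1 / s\<close> and \<open>p = 1 / (2 * s)\<close> it yields the two bounds on
  \<open>lam\<close>.\<close>

lemma inverse_threshold_iff:
  fixes p x :: real
  assumes "x > 0"
  shows "x \<le> inverse (- p + sqrt (p\<^sup>2 + 1)) \<longleftrightarrow> x\<^sup>2 - 2 * p * x - 1 \<le> 0"
proof -
  define q where "q = sqrt (p\<^sup>2 + 1)"
  have q2: "q\<^sup>2 = p\<^sup>2 + 1"
    by (simp add: q_def)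
  have "\<bar>p\<bar> < q"
    unfolding q_def by (rule real_less_rsqrt) simp
  then have pq: "- p + q > 0" "p + q > 0"
    by auto
  have "(- p + q) * (p + q) = 1"
    using q2 by (simp add: algebra_simps power2_eq_square)
  then have "inverse (- p + q) = p + q"
    by (rule inverse_unique)
  moreover have "x\<^sup>2 - 2 * p * x - 1 = (x - (p + q)) * (x + (q - p))"
    using q2 by (simp add: algebra_simps power2_eq_square)
  moreover have "x + (q - p) > 0"
    using pq assms by simp
  ultimately show ?thesis
    by (simp add: q_def[symmetric] mult_le_0_iff)
qed

text \<open>One-sided derivatives of a piecewise function come from the formula of the adjacent piece, as
  long as that formula is also correct at the end point. This treats break points, smooth or
  not, in the same way as inner points.\<close>

lemma has_real_derivative_at_rightI:
  fixes f u :: "real \<Rightarrow> real"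
  assumes "(f has_real_derivative D) (at x)" "x < b"
    and "\<And>y. x \<le> y \<Longrightarrow> y \<le> b \<Longrightarrow> u y = f y"
  shows "(u has_real_derivative D) (at_right x)"
proof -
  have "(u has_real_derivative D) (at x within {x..b})"
    by (rule has_field_derivative_transform_within[where f = f and d = 1])
       (use assms in \<open>auto intro: has_field_derivative_at_within\<close>)
  then show ?thesis
    using at_within_Icc_at_right[OF assms(2)] by simp
qed

lemma has_real_derivative_at_leftI:
  fixes f u :: "real \<Rightarrow> real"
  assumes "(f has_real_derivative D) (at x)" "a < x"
    and "\<And>y. a \<le> y \<Longrightarrow> y \<le> x \<Longrightarrow> u y = f y"
  shows "(u has_real_derivative D) (at_left x)"
proof -
  have "(u has_real_derivative D) (at x within {a..x})"
    by (rule has_field_derivative_transform_within[where f = f and d = 1])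
       (use assms in \<open>auto intro: has_field_derivative_at_within\<close>)
  then show ?thesis
    using at_within_Icc_at_left[OF assms(2)] by simp
qed

lemma has_real_derivative_split:
  fixes u :: "real \<Rightarrow> real"
  assumes "(u has_real_derivative D) (at_left x)" "(u has_real_derivative D) (at_right x)"
  shows "(u has_real_derivative D) (at x)"
  using assms by (simp add: has_field_derivative_iff filterlim_split_at)

lemma lipschitz_imp_abs_cont_on_interval:
  assumes "L-lipschitz_on {a..b} f"
  shows "abs_cont_on_interval a b f"
  unfolding abs_cont_on_interval_def
proof (intro allI impI)
  fix \<epsilon> :: real
  assume "\<epsilon> > 0"
  have L: "L \<ge> 0"
    by (rule lipschitz_on_nonneg[OF assms])
  \<comment> \<open>Adding \<open>1\<close> to the constant keeps the quotient meaningful when \<open>L = 0\<close>.\<close>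
  have "(\<Sum>(s, t)\<in>I. \<bar>f t - f s\<bar>) < \<epsilon>"
    if I: "\<forall>(s, t)\<in>I. a \<le> s \<and> s < t \<and> t \<le> b" "(\<Sum>(s, t)\<in>I. t - s) < \<epsilon> / (L + 1)"
    for I :: "(real \<times> real) set"
  proof -
    have "(\<Sum>(s, t)\<in>I. \<bar>f t - f s\<bar>) \<le> (\<Sum>(s, t)\<in>I. (L + 1) * (t - s))"
    proof (rule sum_mono, clarify)
      fix s t
      assume "(s, t) \<in> I"
      then have st: "a \<le> s" "s < t" "t \<le> b"
        using I(1) by auto
      then have "\<bar>f t - f s\<bar> \<le> L * (t - s)"
        using lipschitz_onD[OF assms, of t s] by (simp add: dist_real_def)
      also have "\<dots> \<le> (L + 1) * (t - s)"
        using st by (intro mult_right_mono) auto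
      finally show "\<bar>f t - f s\<bar> \<le> (L + 1) * (t - s)" .
    qed
    also have "\<dots> = (L + 1) * (\<Sum>(s, t)\<in>I. t - s)"
      by (simp add: sum_distrib_left case_prod_beta)
    also have "\<dots> < \<epsilon>"
      using I(2) L by (simp add: pos_less_divide_eq mult.commute)
    finally show ?thesis .
  qed
  moreover have "\<epsilon> / (L + 1) > 0"
    using L \<open>\<epsilon> > 0\<close> by simp
  ultimately show "\<exists>\<eta>>0. \<forall>I. finite I \<and> (\<forall>(s, t)\<in>I. a \<le> s \<and> s < t \<and> t \<le> b) \<and>
        pairwise (\<lambda>(s, t) (s', t'). disjnt {s<..<t} {s'<..<t'}) I \<and>
        (\<Sum>(s, t)\<in>I. t - s) < \<eta> \<longrightarrow> (\<Sum>(s, t)\<in>I. \<bar>f t - f s\<bar>) < \<epsilon>"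
    by blast
qed

lemma abs_exp_diff_le:
  fixes p q :: real
  assumes "p \<le> 0" "q \<le> 0"
  shows "\<bar>exp p - exp q\<bar> \<le> \<bar>p - q\<bar>"
proof -
  have *: "exp b - exp a \<le> b - a" if "a \<le> b" "b \<le> 0" for a b :: real
  proof -
    have "exp b - exp a = exp b * (1 - exp (a - b))"
      by (simp add: algebra_simps flip: exp_add)
    also have "\<dots> \<le> 1 * (1 - exp (a - b))"
      using that by (intro mult_right_mono) auto
    also have "\<dots> \<le> b - a"
      using exp_ge_add_one_self[of "a - b"] unfolding mult_1_left by linarith
    finally show ?thesis .
  qed
  show ?thesis
  proof (cases "p \<le> q")
    case True
    then show ?thesis
      using *[of p q] assms by simp
  next
    case False
    then show ?thesis
      using *[of q p] assms by simp
  qed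
qed

lemma closure_interior_eq_closure_open:
  fixes U X :: "'a :: topological_space set"
  assumes "open U" "U \<subseteq> X" "X \<subseteq> closure U"
  shows "closure (interior X) = closure U"
proof
  show "closure U \<subseteq> closure (interior X)"
    by (intro closure_mono interior_maximal assms)
  have "interior X \<subseteq> closure U"
    using interior_subset assms(3) by blast
  then show "closure (interior X) \<subseteq> closure U"
    by (rule closure_minimal) simp
qed

lemma deriv_cong_open:
  fixes f h :: "real \<Rightarrow> real"
  assumes "open T" "x \<in> T" "\<And>y. y \<in> T \<Longrightarrow> f y = h y"
  shows "deriv f x = deriv h x"
  by (rule deriv_cong_ev) (use assms in \<open>auto simp: eventually_nhds\<close>)

text \<open>The generator is a local operator, so a function may be replaced by its formula on an open
  piece.\<close>

lemma gen_L_cong_open: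
  assumes "open T" "x \<in> T" "\<And>y. y \<in> T \<Longrightarrow> f y = h y"
  shows "gen_L \<delta> f x = gen_L \<delta> h x"
proof -
  have "deriv (deriv f) x = deriv (deriv h) x"
    by (rule deriv_cong_open[OF assms(1,2)]) (use deriv_cong_open assms in blast)
  with assms show ?thesis
    by (simp add: gen_L_def)
qed

text \<open>This recognises solutions \<open>exp (c * x)\<close> of the homogeneous equation by their first
  derivative alone.\<close>

lemma gen_L_eq_0_if_deriv_proportional:
  fixes f :: "real \<Rightarrow> real"
  assumes "open T" "x \<in> T" "f differentiable (at x)" "c\<^sup>2 = 2 * \<delta>"
    and ode: "\<And>y. y \<in> T \<Longrightarrow> deriv f y = c * f y"
  shows "gen_L \<delta> f x = 0"
proof -
  have "(f has_real_derivative c * f x) (at x)"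
    using assms DERIV_deriv_iff_real_differentiable by metis
  then have "((\<lambda>y. c * f y) has_real_derivative c * (c * f x)) (at x)"
    by (rule DERIV_cmult)
  then have "deriv (\<lambda>y. c * f y) x = c\<^sup>2 * f x"
    by (simp add: DERIV_imp_deriv power2_eq_square)
  moreover have "deriv (deriv f) x = deriv (\<lambda>y. c * f y) x"
    by (rule deriv_cong_open[OF assms(1,2) ode])
  ultimately show ?thesis
    using assms(4) by (simp add: gen_L_def)
qed

section \<open>Thresholds for the data\<close>

text \<open>Squaring turns \<open>\<alpha> > 1 / (2 * lam)\<close> into a quadratic inequality in \<open>2 * lam\<close>. Since \<open>\<alpha>\<^sup>2\<close> then
  exceeds a square, the inequality on the data already forces \<open>\<alpha>\<close> to be well-defined.\<close>

lemma lower_data_ineq_iff: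
  assumes "\<delta> > 0" "lam > 0"
  shows "1/2 * inverse (- (1 / sqrt (2 * \<delta>)) + sqrt (1 / (2 * \<delta>) + 1)) < lam \<longleftrightarrow>
         alpha_well_defined \<delta> lam \<and> alpha \<delta> lam > 1 / (2 * lam)"
proof -
  define t where "t = 1 / sqrt (2 * \<delta>)"
  define r where "r = 1 - t / lam"
  have t2: "1 / (2 * \<delta>) = t\<^sup>2"
    using assms by (simp add: t_def power_divide)
  have "1/2 * inverse (- t + sqrt (t\<^sup>2 + 1)) < lam \<longleftrightarrow>
        \<not> 2 * lam \<le> inverse (- t + sqrt (t\<^sup>2 + 1))"
    by auto
  also have "\<dots> \<longleftrightarrow> (2 * lam)\<^sup>2 - 2 * t * (2 * lam) - 1 > 0"
    using inverse_threshold_iff[of "2 * lam" t] assms by auto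
  also have "(2 * lam)\<^sup>2 - 2 * t * (2 * lam) - 1 = (2 * lam)\<^sup>2 * (r - (1 / (2 * lam))\<^sup>2)"
    using assms by (simp add: r_def field_simps power2_eq_square)
  also have "\<dots> > 0 \<longleftrightarrow> r > (1 / (2 * lam))\<^sup>2"
    using assms by (simp add: zero_less_mult_iff)
  also have "\<dots> \<longleftrightarrow> r \<ge> 0 \<and> sqrt r > 1 / (2 * lam)"
  proof
    assume r: "r > (1 / (2 * lam))\<^sup>2"
    then show "r \<ge> 0 \<and> sqrt r > 1 / (2 * lam)"
      using real_less_rsqrt[OF r] zero_le_power2[of "1 / (2 * lam)"] by linarith
  next
    assume r: "r \<ge> 0 \<and> sqrt r > 1 / (2 * lam)"
    then have "(1 / (2 * lam))\<^sup>2 < (sqrt r)\<^sup>2"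
      using assms by (intro power_strict_mono) auto
    with r show "r > (1 / (2 * lam))\<^sup>2"
      by simp
  qed
  finally show ?thesis
    unfolding alpha_well_defined_def alpha_def t2
    by (simp add: r_def t_def mult.commute)
qed

lemma upper_data_ineq_iff:
  assumes "\<delta> > 0" "lam > 0" "alpha_well_defined \<delta> lam"
  shows "lam \<le> inverse (- (1 / (2 * sqrt (2 * \<delta>))) + sqrt (1 / (8 * \<delta>) + 1)) \<longleftrightarrow>
         alpha \<delta> lam \<le> 1 / lam"
proof -
  define t where "t = 1 / (2 * sqrt (2 * \<delta>))"
  define r where "r = 1 - 2 * t / lam"
  have t2: "1 / (8 * \<delta>) = t\<^sup>2"
    using assms by (simp add: t_def power_divide power_mult_distrib)
  have r: "r = 1 - 1 / (lam * sqrt (2 * \<delta>))"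
    by (simp add: r_def t_def mult.commute)
  have "lam \<le> inverse (- t + sqrt (t\<^sup>2 + 1)) \<longleftrightarrow> lam\<^sup>2 - 2 * t * lam - 1 \<le> 0"
    using inverse_threshold_iff assms by blast
  also have "lam\<^sup>2 - 2 * t * lam - 1 = lam\<^sup>2 * (r - (1 / lam)\<^sup>2)"
    using assms by (simp add: r_def field_simps power2_eq_square)
  also have "\<dots> \<le> 0 \<longleftrightarrow> r \<le> (1 / lam)\<^sup>2"
    using assms by (simp add: mult_le_0_iff)
  also have "\<dots> \<longleftrightarrow> sqrt r \<le> 1 / lam"
    using assms(2,3) real_sqrt_le_iff[of r "(1 / lam)\<^sup>2"] by simp
  finally show ?thesis
    unfolding alpha_def t2 r[symmetric] by (simp add: t_def)
qed

text \<open>The quadratic \<open>lam * x\<^sup>2 - x\<close> takes equal values at points symmetric about \<open>1 / (2 * lam)\<close>.\<close>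

lemma is_beta_iff:
  assumes "lam > 0"
  shows "is_beta \<delta> lam \<beta> \<longleftrightarrow>
         \<beta> = 1 / lam - alpha \<delta> lam \<and> alpha \<delta> lam \<le> 1 / lam \<and> 1 / (2 * lam) < alpha \<delta> lam"
proof -
  let ?a = "alpha \<delta> lam"
  have "lam * \<beta>\<^sup>2 - \<beta> = lam * ?a\<^sup>2 - ?a \<longleftrightarrow> (\<beta> - ?a) * (lam * (\<beta> + ?a) - 1) = 0"
    by (simp add: algebra_simps power2_eq_square)
  also have "\<dots> \<longleftrightarrow> \<beta> = ?a \<or> \<beta> = 1 / lam - ?a"
  proof -
    have "lam * (\<beta> + ?a) = 1 \<longleftrightarrow> \<beta> = 1 / lam - ?a"
      using assms by (auto simp: field_simps)
    then show ?thesis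
      by simp
  qed
  finally have factor: "lam * \<beta>\<^sup>2 - \<beta> = lam * ?a\<^sup>2 - ?a \<longleftrightarrow> \<beta> = ?a \<or> \<beta> = 1 / lam - ?a" .
  have half: "1 / lam = 2 * (1 / (2 * lam))"
    by simp
  show ?thesis
    unfolding is_beta_def factor half by linarith
qed

lemma data_ineqs_iff:
  assumes "\<delta> > 0" "lam > 0"
  shows "data_ineqs \<delta> lam \<longleftrightarrow>
         alpha_well_defined \<delta> lam \<and> 1 / (2 * lam) < alpha \<delta> lam \<and> alpha \<delta> lam \<le> 1 / lam"
  unfolding data_ineqs_def lower_data_ineq_iff[OF assms]
  using upper_data_ineq_iff[OF assms] by blast

section \<open>Geometry of the parameters\<close>

locale admissible_data =
  fixes \<delta> lam \<beta> :: real
  assumes \<delta>_pos: "\<delta> > 0" and lam_pos: "lam > 0"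
    and well_defined: "alpha_well_defined \<delta> lam"
    and beta: "is_beta \<delta> lam \<beta>"
begin

abbreviation "s \<equiv> sqrt (2 * \<delta>)"
abbreviation "\<alpha> \<equiv> alpha \<delta> lam"
abbreviation "A \<equiv> coeff_A \<delta> lam"
abbreviation "u \<equiv> cand_u \<delta> lam \<beta>"
abbreviation "g \<equiv> payoff_g lam"
abbreviation "B \<equiv> {- \<beta>, \<beta>}"

lemma s_pos: "s > 0"
  using \<delta>_pos by simp

lemma beta_bounds: "0 \<le> \<beta>" "\<beta> < \<alpha>" "0 < \<alpha>"
  using beta by (auto simp: is_beta_def)

lemma lam_sum: "lam * (\<alpha> + \<beta>) = 1"
  using beta lam_pos by (simp add: is_beta_iff)

lemma two_lam_beta: "2 * lam * \<beta> < 1"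
proof -
  have "lam * (\<beta> + \<beta>) < lam * (\<alpha> + \<beta>)"
    using lam_pos beta_bounds by (intro mult_strict_left_mono) auto
  then show ?thesis
    using lam_sum by (simp add: algebra_simps)
qed

lemma two_lam_alpha: "1 < 2 * lam * \<alpha>"
  using two_lam_beta lam_sum by (simp add: algebra_simps)

text \<open>The left-hand side is \<open>s\<close> times the common value of \<open>g\<close> and the exponential at \<open>\<alpha>\<close>, that is,
  the descent rate of the exponential there. It equals \<open>1\<close>, which is the smooth fit with the
  line of slope \<open>- 1\<close>.\<close>

lemma alpha_sq: "s * lam * (1 - \<alpha>\<^sup>2) = 1"
proof -
  have "\<alpha>\<^sup>2 = 1 - 1 / (lam * s)"
    using well_defined by (simp add: alpha_def alpha_well_defined_def)
  then show ?thesis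
    using lam_pos s_pos by simp
qed

lemma alpha_less_1: "\<alpha> < 1"
proof (rule ccontr)
  assume "\<not> \<alpha> < 1"
  then have "1 \<le> \<alpha>\<^sup>2"
    by simp
  then have "s * lam * (1 - \<alpha>\<^sup>2) \<le> 0"
    using s_pos lam_pos by (intro mult_nonneg_nonpos) auto
  with alpha_sq show False
    by simp
qed

text \<open>Minus the slope of the exponential piece, normalised at \<open>\<alpha>\<close>.\<close>

lemma A_exp: "s * (A * exp (- s * x)) = exp (- s * (x - \<alpha>))"
proof -
  have "s * (A * exp (- s * x)) = (s * lam * (1 - \<alpha>\<^sup>2)) * (exp (s * \<alpha>) * exp (- s * x))"
    by (simp add: coeff_A_def)
  also have "\<dots> = exp (- s * (x - \<alpha>))"
    by (simp only: alpha_sq mult_1_left flip: exp_add) (simp add: algebra_simps)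
  finally show ?thesis .
qed

lemma A_pos: "A > 0"
proof -
  have "s * (A * exp (- s * 0)) > 0"
    unfolding A_exp by simp
  then show ?thesis
    using s_pos by (simp add: zero_less_mult_iff)
qed

lemma A_exp_alpha: "A * exp (- s * \<alpha>) = lam * (1 - \<alpha>\<^sup>2)"
  by (simp add: coeff_A_def flip: exp_add)

section \<open>Derivative of the candidate\<close>

text \<open>The formulas of the three pieces are also valid at the common end points, so that they
  can serve for one-sided derivatives there.\<close>

lemma u_minus: "u (- x) = u x"
  by (simp add: cand_u_def)

lemma u_inner: "\<bar>x\<bar> \<le> \<beta> \<Longrightarrow> u x = lam - lam * x\<^sup>2"
  by (simp add: cand_u_def)

lemma u_middle: "\<beta> \<le> \<bar>x\<bar> \<Longrightarrow> \<bar>x\<bar> \<le> \<alpha> \<Longrightarrow> u x = - \<bar>x\<bar> - lam * \<alpha>\<^sup>2 + \<alpha> + lam"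
proof (cases "\<bar>x\<bar> = \<beta>")
  case True
  then have "x\<^sup>2 = \<beta>\<^sup>2"
    by (metis power2_abs)
  moreover have "lam * \<beta>\<^sup>2 - \<beta> = lam * \<alpha>\<^sup>2 - \<alpha>"
    using beta by (simp add: is_beta_def)
  ultimately show ?thesis
    using True by (simp add: cand_u_def)
qed (simp add: cand_u_def)

lemma u_outer: "\<alpha> \<le> \<bar>x\<bar> \<Longrightarrow> u x = A * exp (- s * \<bar>x\<bar>)"
proof (cases "\<bar>x\<bar> = \<alpha>")
  case True
  then show ?thesis
    using A_exp_alpha beta_bounds by (simp add: cand_u_def algebra_simps)
qed (use beta_bounds in \<open>simp add: cand_u_def\<close>)

text \<open>The derivative of the candidate outside the kinks. Truncating \<open>\<bar>x\<bar> - \<alpha>\<close> at \<open>0\<close> joins the line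
  and the exponential in one formula, which makes the Lipschitz bound across \<open>\<alpha>\<close> immediate.\<close>

definition du :: "real \<Rightarrow> real" where
  "du x = (if \<bar>x\<bar> < \<beta> then - 2 * lam * x else - sgn x * exp (- s * max 0 (\<bar>x\<bar> - \<alpha>)))"

lemma du_minus: "du (- x) = - du x"
  by (simp add: du_def)

lemma deriv_quadratic: "((\<lambda>x. lam - lam * x\<^sup>2) has_real_derivative - 2 * lam * x) (at x)"
  by (auto intro!: derivative_eq_intros)

lemma deriv_linear: "((\<lambda>x. - x - lam * \<alpha>\<^sup>2 + \<alpha> + lam) has_real_derivative - 1) (at x)"
  by (auto intro!: derivative_eq_intros)

lemma deriv_exponential:
  "((\<lambda>x. A * exp (- s * x)) has_real_derivative - exp (- s * (x - \<alpha>))) (at x)"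
proof -
  have "((\<lambda>x. A * exp (- s * x)) has_real_derivative - (s * (A * exp (- s * x)))) (at x)"
    by (auto intro!: derivative_eq_intros)
  then show ?thesis
    by (simp only: A_exp)
qed

lemma u_deriv_right_middle:
  "\<beta> \<le> x \<Longrightarrow> x < \<alpha> \<Longrightarrow> (u has_real_derivative - 1) (at_right x)"
  by (rule has_real_derivative_at_rightI[OF deriv_linear])
     (use beta_bounds in \<open>auto simp: u_middle\<close>)

lemma u_deriv_left_middle:
  "\<beta> < x \<Longrightarrow> x \<le> \<alpha> \<Longrightarrow> (u has_real_derivative - 1) (at_left x)"
  by (rule has_real_derivative_at_leftI[OF deriv_linear])
     (use beta_bounds in \<open>auto simp: u_middle\<close>)

lemma u_deriv_right_outer:
  "\<alpha> \<le> x \<Longrightarrow> (u has_real_derivative - exp (- s * (x - \<alpha>))) (at_right x)"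
  by (rule has_real_derivative_at_rightI[OF deriv_exponential, of _ "x + 1"])
     (use beta_bounds in \<open>auto simp: u_outer\<close>)

lemma u_deriv_left_outer:
  "\<alpha> < x \<Longrightarrow> (u has_real_derivative - exp (- s * (x - \<alpha>))) (at_left x)"
  by (rule has_real_derivative_at_leftI[OF deriv_exponential])
     (use beta_bounds in \<open>auto simp: u_outer\<close>)

lemma u_deriv_inner_right:
  "- \<beta> \<le> x \<Longrightarrow> x < \<beta> \<Longrightarrow> (u has_real_derivative - 2 * lam * x) (at_right x)"
  by (rule has_real_derivative_at_rightI[OF deriv_quadratic]) (auto simp: u_inner)

lemma u_deriv_inner_left:
  "- \<beta> < x \<Longrightarrow> x \<le> \<beta> \<Longrightarrow> (u has_real_derivative - 2 * lam * x) (at_left x)"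
  by (rule has_real_derivative_at_leftI[OF deriv_quadratic]) (auto simp: u_inner)

lemma u_deriv_left_minus_beta: "(u has_real_derivative 1) (at_left (- \<beta>))"
proof (rule has_real_derivative_at_leftI[of "\<lambda>x. x - lam * \<alpha>\<^sup>2 + \<alpha> + lam" _ _ "- \<alpha>"])
  show "((\<lambda>x. x - lam * \<alpha>\<^sup>2 + \<alpha> + lam) has_real_derivative 1) (at (- \<beta>))"
    by (auto intro!: derivative_eq_intros)
qed (use beta_bounds in \<open>auto simp: u_middle\<close>)

lemma u_deriv_pos:
  assumes "\<beta> < x"
  shows "(u has_real_derivative du x) (at x)"
proof -
  have x: "0 < x" "\<not> \<bar>x\<bar> < \<beta>"
    using assms beta_bounds by auto
  consider "x < \<alpha>" | "x = \<alpha>" | "\<alpha> < x"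
    by linarith
  then show ?thesis
  proof cases
    case 1
    then have "du x = - 1"
      using x by (simp add: du_def)
    with 1 assms show ?thesis
      using has_real_derivative_split u_deriv_left_middle u_deriv_right_middle by simp
  next
    case 2
    then have "du x = - 1"
      using x by (simp add: du_def)
    with 2 assms show ?thesis
      using has_real_derivative_split u_deriv_left_middle[of x] u_deriv_right_outer[of x] by simp
  next
    case 3
    then have "du x = - exp (- s * (x - \<alpha>))"
      using x by (simp add: du_def)
    with 3 show ?thesis
      using has_real_derivative_split u_deriv_left_outer[of x] u_deriv_right_outer[of x] by simp
  qed
qed

lemma u_deriv:
  assumes "x \<notin> B"
  shows "(u has_real_derivative du x) (at x)"
proof -
  consider "x < - \<beta>" | "- \<beta> < x" "x < \<beta>" | "\<beta> < x"
    using assms by auto linarith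
  then show ?thesis
  proof cases
    case 1
    then have "(u has_real_derivative du (- x)) (at (- x))"
      by (intro u_deriv_pos) simp
    then have "((\<lambda>x. u (- x)) has_real_derivative - du (- x)) (at x)"
      by (simp only: DERIV_mirror)
    then show ?thesis
      by (simp add: u_minus du_minus)
  next
    case 2
    then have "du x = - 2 * lam * x"
      by (simp add: du_def)
    with 2 show ?thesis
      using has_real_derivative_split u_deriv_inner_left[of x] u_deriv_inner_right[of x] by simp
  next
    case 3
    then show ?thesis
      by (rule u_deriv_pos)
  qed
qed

lemma deriv_u: "x \<notin> B \<Longrightarrow> deriv u x = du x"
  using u_deriv by (blast intro: DERIV_imp_deriv)

text \<open>At the kinks continuity follows from the existence of both one-sided derivatives.\<close>

lemma u_continuous: "continuous_on UNIV u"
proof -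
  have "isCont u x" for x
  proof (cases "x \<in> B")
    case False
    then show ?thesis
      using u_deriv DERIV_isCont by blast
  next
    case True
    \<comment> \<open>For \<open>\<beta> = 0\<close> the parabolic piece is a single point and gives no one-sided derivative.\<close>
    consider "\<beta> = 0" | "\<beta> > 0"
      using beta_bounds by linarith
    then have "\<exists>l r. (u has_real_derivative l) (at_left x) \<and> (u has_real_derivative r) (at_right x)"
    proof cases
      case 1
      with True show ?thesis
        using u_deriv_left_minus_beta u_deriv_right_middle[of 0] beta_bounds by auto
    next
      case 2
      with True show ?thesis
        using u_deriv_left_minus_beta u_deriv_right_middle[of \<beta>] beta_bounds
          u_deriv_inner_left[of \<beta>] u_deriv_inner_right[of "- \<beta>"] by auto
    qed
    then show ?thesis
      by (auto simp: continuous_at_split dest: DERIV_continuous)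
  qed
  then show ?thesis
    by (simp add: continuous_on_eq_continuous_at)
qed

text \<open>On each component of the complement of the kinks the derivative is Lipschitz, which gives
  both its continuity and its absolute continuity.\<close>

lemma du_lipschitz_right: "s-lipschitz_on {\<beta><..} du"
proof (rule lipschitz_onI)
  fix x y
  assume "x \<in> {\<beta><..}" "y \<in> {\<beta><..}"
  then have "dist (du x) (du y) =
      \<bar>exp (- s * max 0 (y - \<alpha>)) - exp (- s * max 0 (x - \<alpha>))\<bar>"
    using beta_bounds by (simp add: du_def dist_real_def)
  also have "\<dots> \<le> \<bar>- s * max 0 (y - \<alpha>) - - s * max 0 (x - \<alpha>)\<bar>"
    using s_pos by (intro abs_exp_diff_le) (auto simp: mult_nonpos_nonneg)
  also have "\<dots> = s * \<bar>max 0 (x - \<alpha>) - max 0 (y - \<alpha>)\<bar>"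
    using s_pos by (simp add: abs_mult flip: right_diff_distrib)
  also have "\<dots> \<le> s * dist x y"
    using s_pos by (intro mult_left_mono) (auto simp: dist_real_def)
  finally show "dist (du x) (du y) \<le> s * dist x y" .
qed (use s_pos in simp)

lemma du_lipschitz_left: "s-lipschitz_on {..<- \<beta>} du"
proof (rule lipschitz_onI)
  fix x y
  assume "x \<in> {..<- \<beta>}" "y \<in> {..<- \<beta>}"
  then have "dist (du (- x)) (du (- y)) \<le> s * dist (- x) (- y)"
    by (intro lipschitz_onD[OF du_lipschitz_right]) auto
  then show "dist (du x) (du y) \<le> s * dist x y"
    by (simp add: du_minus dist_minus)
qed (use s_pos in simp)

lemma du_lipschitz_inner: "(2 * lam)-lipschitz_on {- \<beta><..<\<beta>} du"
proof (rule lipschitz_onI)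
  fix x y
  assume "x \<in> {- \<beta><..<\<beta>}" "y \<in> {- \<beta><..<\<beta>}"
  then have "du x = - 2 * lam * x" "du y = - 2 * lam * y"
    by (auto simp: du_def)
  then have "dist (du x) (du y) = \<bar>2 * lam * (y - x)\<bar>"
    by (simp add: dist_real_def algebra_simps)
  then show "dist (du x) (du y) \<le> 2 * lam * dist x y"
    using lam_pos by (simp add: abs_mult dist_real_def)
qed (use lam_pos in simp)

lemma deriv_u_lipschitz:
  assumes "X \<subseteq> {..<- \<beta>} \<or> X \<subseteq> {- \<beta><..<\<beta>} \<or> X \<subseteq> {\<beta><..}"
  shows "\<exists>L. L-lipschitz_on X (deriv u)"
proof -
  have "\<exists>L. L-lipschitz_on X du"
    using assms du_lipschitz_left du_lipschitz_inner du_lipschitz_right lipschitz_on_subset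
    by blast
  moreover have "\<And>x. x \<in> X \<Longrightarrow> deriv u x = du x"
    using assms beta_bounds by (intro deriv_u) auto
  ultimately show ?thesis
    by (auto simp: lipschitz_on_def)
qed

lemma deriv_u_abs_cont: "abs_cont_inside (- B) (deriv u)"
  unfolding abs_cont_inside_def
proof (intro allI impI, elim conjE)
  fix a b
  assume ab: "a \<le> b" "{a..b} \<subseteq> - B"
  then have "- \<beta> \<notin> {a..b}" "\<beta> \<notin> {a..b}"
    by auto
  then have "b < - \<beta> \<or> - \<beta> < a \<and> b < \<beta> \<or> \<beta> < a"
    using ab(1) by auto
  then have "{a..b} \<subseteq> {..<- \<beta>} \<or> {a..b} \<subseteq> {- \<beta><..<\<beta>} \<or> {a..b} \<subseteq> {\<beta><..}"
    by auto
  then show "abs_cont_on_interval a b (deriv u)"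
    using deriv_u_lipschitz lipschitz_imp_abs_cont_on_interval by blast
qed

lemma deriv_u_continuous: "continuous_on (- B) (deriv u)"
proof -
  have eq: "- B = {..<- \<beta>} \<union> {- \<beta><..<\<beta>} \<union> {\<beta><..}"
    using beta_bounds by auto
  have "continuous_on X (deriv u)"
    if "X \<subseteq> {..<- \<beta>} \<or> X \<subseteq> {- \<beta><..<\<beta>} \<or> X \<subseteq> {\<beta><..}" for X
    using deriv_u_lipschitz[OF that] lipschitz_on_continuous_on by blast
  then show ?thesis
    unfolding eq by (intro continuous_on_open_Un open_Un) auto
qed

section \<open>The regions\<close>

lemma abs_du_outer: "\<bar>x\<bar> > \<beta> \<Longrightarrow> \<bar>du x\<bar> = exp (- s * max 0 (\<bar>x\<bar> - \<alpha>))"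
  using beta_bounds by (auto simp: du_def abs_mult sgn_if)

lemma abs_du_inner: "\<bar>x\<bar> < \<beta> \<Longrightarrow> \<bar>du x\<bar> < 1"
proof -
  assume x: "\<bar>x\<bar> < \<beta>"
  then have "\<bar>du x\<bar> = 2 * lam * \<bar>x\<bar>"
    using lam_pos by (simp add: du_def abs_mult)
  also have "\<dots> \<le> 2 * lam * \<beta>"
    using x lam_pos by simp
  finally show "\<bar>du x\<bar> < 1"
    using two_lam_beta by simp
qed

lemma notin_B: "x \<notin> B \<longleftrightarrow> \<bar>x\<bar> < \<beta> \<or> \<beta> < \<bar>x\<bar>"
  using beta_bounds by auto

lemma abs_deriv_u_le: "x \<notin> B \<Longrightarrow> \<bar>deriv u x\<bar> \<le> 1"
proof -
  assume "x \<notin> B"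
  moreover have "\<bar>du x\<bar> \<le> 1" if "\<beta> < \<bar>x\<bar>"
    unfolding abs_du_outer[OF that] using s_pos by (simp add: mult_nonpos_nonneg)
  ultimately show ?thesis
    using abs_du_inner[of x] deriv_u[of x] unfolding notin_B by fastforce
qed

lemma abs_deriv_u_eq_1: "{x. x \<notin> B \<and> \<bar>deriv u x\<bar> = 1} = {x. \<beta> < \<bar>x\<bar> \<and> \<bar>x\<bar> \<le> \<alpha>}"
proof -
  have "\<bar>du x\<bar> = 1 \<longleftrightarrow> \<bar>x\<bar> \<le> \<alpha>" if "\<beta> < \<bar>x\<bar>" for x
    unfolding abs_du_outer[OF that] using s_pos by (auto simp: max_def)
  then have "x \<notin> B \<and> \<bar>deriv u x\<bar> = 1 \<longleftrightarrow> \<beta> < \<bar>x\<bar> \<and> \<bar>x\<bar> \<le> \<alpha>" for x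
    using abs_du_inner[of x] deriv_u[of x] notin_B[of x] by force
  then show ?thesis
    by blast
qed

text \<open>The open set where \<open>u < g\<close>, by \<open>u_less_g\<close> and \<open>u_greater_g\<close> below. Its closure is at once the
  control region and the second stopping region.\<close>

definition U :: "real set" where
  "U = {- \<alpha><..<- \<beta>} \<union> {\<beta><..<\<alpha>}"

lemma U_eq: "U = {x. \<beta> < \<bar>x\<bar> \<and> \<bar>x\<bar> < \<alpha>}"
proof -
  have "x \<in> U \<longleftrightarrow> \<beta> < \<bar>x\<bar> \<and> \<bar>x\<bar> < \<alpha>" for x
    unfolding U_def Un_iff greaterThanLessThan_iff using beta_bounds by linarith
  then show ?thesis
    by blast
qed

lemma closure_U: "closure U = {- \<alpha>..- \<beta>} \<union> {\<beta>..\<alpha>}"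
  using beta_bounds by (simp add: U_def)

lemma closure_U_eq: "closure U = {x. \<beta> \<le> \<bar>x\<bar> \<and> \<bar>x\<bar> \<le> \<alpha>}"
proof -
  have "x \<in> closure U \<longleftrightarrow> \<beta> \<le> \<bar>x\<bar> \<and> \<bar>x\<bar> \<le> \<alpha>" for x
    unfolding closure_U Un_iff atLeastAtMost_iff using beta_bounds by linarith
  then show ?thesis
    by blast
qed

lemma control_region_eq: "control_region B u = closure U"
  unfolding control_region_def abs_deriv_u_eq_1
proof (rule closure_interior_eq_closure_open)
  show "open U"
    unfolding U_def by (intro open_Un open_greaterThanLessThan)
  show "U \<subseteq> {x. \<beta> < \<bar>x\<bar> \<and> \<bar>x\<bar> \<le> \<alpha>}"
    unfolding U_eq by (intro Collect_mono) simp
  show "{x. \<beta> < \<bar>x\<bar> \<and> \<bar>x\<bar> \<le> \<alpha>} \<subseteq> closure U"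
    unfolding closure_U_eq by (intro Collect_mono) simp
qed

text \<open>The line is the chord of the strictly concave parabola over \<open>[\<beta>, \<alpha>]\<close>.\<close>

lemma u_less_g:
  assumes "\<beta> < \<bar>x\<bar>" "\<bar>x\<bar> < \<alpha>"
  shows "u x < g x"
proof -
  have "u x - g x = (\<bar>x\<bar> - \<alpha>) * (lam * (\<bar>x\<bar> + \<alpha>) - 1)"
    using assms alpha_less_1
    by (simp add: u_middle payoff_g_def algebra_simps power2_eq_square)
  moreover have "lam * (\<bar>x\<bar> + \<alpha>) - 1 = lam * (\<bar>x\<bar> - \<beta>)"
    using lam_sum by (simp add: algebra_simps)
  ultimately have "u x - g x < 0"
    using assms lam_pos by (simp add: mult_neg_pos)
  then show ?thesis
    by simp
qed

text \<open>Compare both functions with the line of slope \<open>- 1\<close> through their common value at \<open>\<alpha>\<close>: it is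
  the tangent of the convex exponential, and the concave parabola falls faster because
  \<open>2 * lam * \<alpha> > 1\<close>. Outside \<open>[-1, 1]\<close> the payoff vanishes.\<close>

lemma u_greater_g:
  assumes "\<alpha> < \<bar>x\<bar>"
  shows "g x < u x"
proof (cases "\<bar>x\<bar> \<le> 1")
  case False
  then show ?thesis
    using assms A_pos by (simp add: payoff_g_def u_outer)
next
  case True
  define y where "y = \<bar>x\<bar> - \<alpha>"
  have y: "y > 0"
    using assms by (simp add: y_def)
  have "g x = lam * (1 - \<alpha>\<^sup>2) - (2 * lam * \<alpha>) * y - lam * y\<^sup>2"
  proof -
    have "x\<^sup>2 = (\<alpha> + y)\<^sup>2"
      by (simp add: y_def)
    then show ?thesis
      using True by (simp add: payoff_g_def algebra_simps power2_eq_square)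
  qed
  also have "\<dots> < lam * (1 - \<alpha>\<^sup>2) - y"
  proof -
    have "1 * y < 2 * lam * \<alpha> * y"
      using y two_lam_alpha by (intro mult_strict_right_mono) auto
    moreover have "0 \<le> lam * y\<^sup>2"
      using lam_pos by simp
    ultimately show ?thesis
      by linarith
  qed
  also have "\<dots> = lam * (1 - \<alpha>\<^sup>2) * (1 - s * y)"
  proof -
    have "lam * (1 - \<alpha>\<^sup>2) * (1 - s * y) = lam * (1 - \<alpha>\<^sup>2) - (s * lam * (1 - \<alpha>\<^sup>2)) * y"
      by (simp add: algebra_simps)
    then show ?thesis
      by (simp only: alpha_sq mult_1_left)
  qed
  also have "\<dots> \<le> lam * (1 - \<alpha>\<^sup>2) * exp (- s * y)"
  proof (rule mult_left_mono)
    show "1 - s * y \<le> exp (- s * y)"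
      using exp_ge_add_one_self[of "- s * y"] by simp
    show "0 \<le> lam * (1 - \<alpha>\<^sup>2)"
      using A_pos unfolding A_exp_alpha[symmetric] by simp
  qed
  also have "\<dots> = A * (exp (- s * \<alpha>) * exp (- s * y))"
    by (simp add: A_exp_alpha[symmetric])
  also have "\<dots> = u x"
    using assms by (simp add: u_outer y_def algebra_simps flip: exp_add)
  finally show ?thesis .
qed

lemma u_eq_g_inner: "\<bar>x\<bar> \<le> \<beta> \<Longrightarrow> u x = g x"
  using beta_bounds alpha_less_1 by (simp add: u_inner payoff_g_def)

lemma u_eq_g_alpha: "\<bar>x\<bar> = \<alpha> \<Longrightarrow> u x = g x"
proof -
  assume "\<bar>x\<bar> = \<alpha>"
  moreover from this have "x\<^sup>2 = \<alpha>\<^sup>2"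
    by (metis power2_abs)
  ultimately show ?thesis
    using beta_bounds alpha_less_1 by (simp add: u_middle payoff_g_def)
qed

lemma stop_region_W_eq: "stop_region_W g u = {- \<beta>..\<beta>} \<union> {\<alpha>} \<union> {- \<alpha>}"
proof -
  have "u x = g x \<longleftrightarrow> \<bar>x\<bar> \<le> \<beta> \<or> \<bar>x\<bar> = \<alpha>" for x
    using u_less_g[of x] u_greater_g[of x] u_eq_g_inner[of x] u_eq_g_alpha[of x]
    by linarith
  also have "\<bar>x\<bar> \<le> \<beta> \<or> \<bar>x\<bar> = \<alpha> \<longleftrightarrow> x \<in> {- \<beta>..\<beta>} \<union> {\<alpha>} \<union> {- \<alpha>}" for x
    unfolding Un_iff atLeastAtMost_iff singleton_iff using beta_bounds by linarith
  finally show ?thesis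
    unfolding stop_region_W_def by blast
qed

lemma stop_region_C_eq: "stop_region_C g u = closure U"
proof -
  have "u x < g x \<longleftrightarrow> \<beta> < \<bar>x\<bar> \<and> \<bar>x\<bar> < \<alpha>" for x
    using u_less_g[of x] u_greater_g[of x] u_eq_g_inner[of x] u_eq_g_alpha[of x]
    by linarith
  then show ?thesis
    by (simp add: stop_region_C_def U_eq)
qed

lemma wait_region_eq: "wait_region B g u = {x. \<alpha> < \<bar>x\<bar>}"
proof -
  have "x \<in> wait_region B g u \<longleftrightarrow> \<alpha> < \<bar>x\<bar>" for x
    unfolding wait_region_def stop_region_def control_region_eq stop_region_C_eq
      stop_region_W_eq closure_U_eq Compl_iff Un_iff mem_Collect_eq atLeastAtMost_iff
      singleton_iff
    using beta_bounds by linarith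
  then show ?thesis
    by blast
qed

section \<open>The variational inequalities and the kinks\<close>

lemma gen_L_wait:
  assumes "\<alpha> < \<bar>x\<bar>"
  shows "gen_L \<delta> u x = 0"
proof -
  have ode: "deriv u z = - sgn z * s * u z" if "\<alpha> < \<bar>z\<bar>" for z
  proof -
    have "exp (- s * (\<bar>z\<bar> - \<alpha>)) = s * u z"
      using that by (simp only: u_outer A_exp[symmetric] less_imp_le)
    moreover have "deriv u z = - sgn z * exp (- s * (\<bar>z\<bar> - \<alpha>))"
      using that beta_bounds deriv_u[of z] unfolding notin_B by (simp add: du_def)
    ultimately show ?thesis
      by simp
  qed
  have diff: "u differentiable (at x)"
    using assms beta_bounds u_deriv[of x] unfolding notin_B real_differentiable_def by auto
  have s2: "s\<^sup>2 = 2 * \<delta>"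
    using \<delta>_pos by simp
  consider "\<alpha> < x" | "x < - \<alpha>"
    using assms by linarith
  then show ?thesis
  proof cases
    case 1
    show ?thesis
      by (rule gen_L_eq_0_if_deriv_proportional[of "{\<alpha><..}" _ _ "- s"])
         (use 1 diff s2 beta_bounds ode in auto)
  next
    case 2
    show ?thesis
      by (rule gen_L_eq_0_if_deriv_proportional[of "{..<- \<alpha>}" _ _ s])
         (use 2 diff s2 beta_bounds ode in auto)
  qed
qed

lemma gen_L_g:
  assumes "\<bar>x\<bar> < 1"
  shows "gen_L \<delta> g x \<le> 0"
proof -
  have "gen_L \<delta> g x = gen_L \<delta> (\<lambda>x. lam - lam * x\<^sup>2) x"
    by (rule gen_L_cong_open[where T = "{- 1<..<1}"]) (use assms in \<open>auto simp: payoff_g_def\<close>)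
  also have "\<dots> = - lam - \<delta> * (lam * (1 - x\<^sup>2))"
  proof -
    have "deriv (\<lambda>x. lam - lam * x\<^sup>2) = (\<lambda>x. - 2 * lam * x)"
      using deriv_quadratic DERIV_imp_deriv by blast
    moreover have "deriv (\<lambda>x. - 2 * lam * x) x = - 2 * lam"
      by (rule DERIV_imp_deriv[OF DERIV_cmult_Id])
    ultimately show ?thesis
      by (simp only: gen_L_def) (simp add: algebra_simps)
  qed
  also have "\<dots> \<le> 0"
  proof -
    have "x\<^sup>2 \<le> 1"
      using assms by (simp add: abs_square_le_1)
    then have "0 \<le> \<delta> * (lam * (1 - x\<^sup>2))"
      using \<delta>_pos lam_pos by simp
    then show ?thesis
      using lam_pos by simp
  qed
  finally show ?thesis .
qed

lemma gen_L_stop: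
  assumes "x \<in> interior (stop_region_W g u)"
  shows "gen_L \<delta> u x = gen_L \<delta> g x \<and> gen_L \<delta> g x \<le> 0"
proof
  show "gen_L \<delta> u x = gen_L \<delta> g x"
    by (rule gen_L_cong_open[OF open_interior assms])
       (use interior_subset in \<open>auto simp: stop_region_W_def\<close>)
  have "x \<in> stop_region_W g u"
    using assms interior_subset by blast
  then show "gen_L \<delta> g x \<le> 0"
    using beta_bounds alpha_less_1 by (intro gen_L_g) (auto simp: stop_region_W_eq)
qed

lemma u_nonneg: "0 \<le> u x"
proof (cases "\<alpha> < \<bar>x\<bar>")
  case True
  then show ?thesis
    using A_pos by (simp add: u_outer)
next
  case False
  have "\<bar>x\<bar> \<le> \<beta> \<Longrightarrow> x\<^sup>2 \<le> 1"
    using beta_bounds alpha_less_1 by (simp add: abs_square_le_1)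
  moreover have "u x \<ge> 0" if "\<beta> < \<bar>x\<bar>"
  proof -
    have "0 \<le> lam * (1 - \<alpha>\<^sup>2)"
      using A_pos unfolding A_exp_alpha[symmetric] by simp
    with that False show ?thesis
      by (simp add: u_middle algebra_simps)
  qed
  ultimately show ?thesis
    using lam_pos u_inner[of x] by (cases "\<bar>x\<bar> \<le> \<beta>") auto
qed

text \<open>If \<open>\<beta> > 0\<close>, the kink at \<open>- \<beta>\<close> is of the first kind and the one at \<open>\<beta>\<close> of the second. If
  \<open>\<beta> = 0\<close>, the inner piece is a single point and the slopes at the only kink are those of the
  two lines.\<close>

lemma kinks:
  assumes "c \<in> B"
  shows "\<exists>l r. (u has_real_derivative l) (at_left c) \<and>
           (u has_real_derivative r) (at_right c) \<and> (l = 1 \<and> r < 1 \<or> l > -1 \<and> r = -1)"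
proof (cases "\<beta> = 0")
  case True
  then show ?thesis
    using assms u_deriv_left_minus_beta u_deriv_right_middle[of 0] beta_bounds
    by (intro exI[of _ 1] exI[of _ "- 1"]) simp
next
  case False
  with beta_bounds have "\<beta> > 0"
    by simp
  from assms consider "c = - \<beta>" | "c = \<beta>"
    by auto
  then show ?thesis
  proof cases
    case 1
    then show ?thesis
      using u_deriv_left_minus_beta u_deriv_inner_right[of "- \<beta>"] \<open>\<beta> > 0\<close> two_lam_beta
      by (intro exI[of _ 1] exI[of _ "2 * lam * \<beta>"]) simp
  next
    case 2
    then show ?thesis
      using u_deriv_inner_left[of \<beta>] u_deriv_right_middle[of \<beta>] \<open>\<beta> > 0\<close> two_lam_beta beta_bounds
      by (intro exI[of _ "- 2 * lam * \<beta>"] exI[of _ "- 1"]) simp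
  qed
qed

lemma finite_union_closure_U: "finite_union_of_intervals (closure U)"
  unfolding finite_union_of_intervals_def closure_U
  by (rule exI[of _ "{{- \<alpha>..- \<beta>}, {\<beta>..\<alpha>}}"]) auto

lemma finite_union_stop_region_W: "finite_union_of_intervals (stop_region_W g u)"
  unfolding finite_union_of_intervals_def
proof (intro exI conjI)
  let ?F = "{{- \<beta>..\<beta>}, {\<alpha>..\<alpha>}, {- \<alpha>..- \<alpha>}}"
  show "finite ?F"
    by simp
  show "\<forall>I\<in>?F. is_interval I"
    using is_interval_cc by blast
  show "stop_region_W g u = \<Union>?F"
    unfolding stop_region_W_eq by simp
qed

text \<open>The control region is contained in the stopping region, so the open set on which the generator
  has to be nonnegative is empty.\<close>

lemma candidate_u: "candidate \<delta> (\<lambda>x. 0) g u"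
proof -
  have "B \<subseteq> stop_region_C g u"
    using beta_bounds by (auto simp: stop_region_C_eq closure_U_eq)
  moreover have "closure U - stop_region g u = {}"
    by (auto simp: stop_region_def stop_region_C_eq)
  then have "interior (closure U - stop_region g u) = {}"
    by (metis interior_empty)
  moreover have "u differentiable (at x)" if "x \<notin> B" for x
    using u_deriv[OF that] by (auto simp: real_differentiable_def)
  ultimately have "candidate_wrt \<delta> (\<lambda>x. 0) g B u"
    unfolding candidate_wrt_def
    using u_nonneg u_continuous deriv_u_continuous deriv_u_abs_cont abs_deriv_u_le
      finite_union_closure_U finite_union_stop_region_W gen_L_wait gen_L_stop kinks
    by (simp add: control_region_eq stop_region_C_eq wait_region_eq)
  then show ?thesis
    unfolding candidate_def by blast
qed

end

theorem proposition7:
  fixes \<delta> lam :: real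
  assumes "\<delta> > 0" and "lam > 0"
  shows "((alpha_well_defined \<delta> lam \<and> alpha \<delta> lam > 1 / (2 * lam) \<and> (\<exists>\<beta>. is_beta \<delta> lam \<beta>))
            \<longleftrightarrow> data_ineqs \<delta> lam) \<and>
         (data_ineqs \<delta> lam \<longrightarrow>
            (\<forall>\<beta>. is_beta \<delta> lam \<beta> \<longrightarrow> \<beta> < 1 / (2 * lam)) \<and>
            coeff_A \<delta> lam > 0 \<and> alpha \<delta> lam \<in> {0<..<1} \<and>
            (\<forall>\<beta>. is_beta \<delta> lam \<beta> \<longrightarrow>
               candidate \<delta> (\<lambda>x. 0) (payoff_g lam) (cand_u \<delta> lam \<beta>)))"
proof (intro conjI impI)
  show iff: "(alpha_well_defined \<delta> lam \<and> alpha \<delta> lam > 1 / (2 * lam) \<and> (\<exists>\<beta>. is_beta \<delta> lam \<beta>))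
      \<longleftrightarrow> data_ineqs \<delta> lam"
    using assms by (auto simp: data_ineqs_iff is_beta_iff)
  assume D: "data_ineqs \<delta> lam"
  then obtain \<beta>\<^sub>0 where \<beta>\<^sub>0: "is_beta \<delta> lam \<beta>\<^sub>0"
    using iff by blast
  have adm: "admissible_data \<delta> lam \<beta>" if "is_beta \<delta> lam \<beta>" for \<beta>
    using D that assms iff by unfold_locales auto
  show "\<forall>\<beta>. is_beta \<delta> lam \<beta> \<longrightarrow> \<beta> < 1 / (2 * lam)"
    using admissible_data.two_lam_beta[OF adm] assms by (auto simp: field_simps)
  show "coeff_A \<delta> lam > 0"
    by (rule admissible_data.A_pos[OF adm[OF \<beta>\<^sub>0]])
  show "alpha \<delta> lam \<in> {0<..<1}"
    using admissible_data.alpha_less_1[OF adm[OF \<beta>\<^sub>0]]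
      admissible_data.beta_bounds(3)[OF adm[OF \<beta>\<^sub>0]] by simp
  show "\<forall>\<beta>. is_beta \<delta> lam \<beta> \<longrightarrow> candidate \<delta> (\<lambda>x. 0) (payoff_g lam) (cand_u \<delta> lam \<beta>)"
    using admissible_data.candidate_u[OF adm] by blast
qed

end
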